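(* Let $0<\epsilon\le 1/2$ and $\epsilon_c = 1-\sqrt{2}/2$. Consider the saturated two-queue system with one-slot switchover delay and symmetric Gilbert-Elliot channels with parameter $\epsilon$, and let $\mathbf{\Lambda}_s$ be its rate region. Then $\mathbf{\Lambda}_s$ is the set of all $(r_1,r_2)$ with $r_1\ge 0$, $r_2\ge 0$ that satisfy: for $\epsilon<\epsilon_c$, $$\epsilon r_1+(1-\epsilon)^2 r_2\le \tfrac{(1-\epsilon)^2}{2},$$ $$(1-\epsilon)r_1+(1+\epsilon-\epsilon^2)r_2\le \tfrac34-\tfrac{\epsilon}{2},$$ $$r_1+r_2\le \tfrac34-\tfrac{\epsilon}{2},$$ $$(1+\epsilon-\epsilon^2)r_1+(1-\epsilon)r_2\le \tfrac34-\tfrac{\epsilon}{2},$$ $$(1-\epsilon)^2 r_1+\epsilon r_2\le \tfrac{(1-\epsilon)^2}{2};$$ and for $\epsilon\ge\epsilon_c$, $$r_1+(1-\epsilon)(3-2\epsilon)r_2\le \tfrac{(1-\epsilon)(3-2\epsilon)}{2},$$ $$r_1+r_2\le \tfrac34-\tfrac{\epsilon}{2},$$ $$(1-\epsilon)(3-2\epsilon)r_1+r_2\le \tfrac{(1-\epsilon)(3-2\epsilon)}{2}.$$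
   Context: Saturated system (both queues always nonempty): a Markov decision process with state $\mathbf{s}_t=(m(t),C_1(t),C_2(t))\in\mathcal{S}=\{1,2\}\times\{0,1\}^2$, where $m(t)$ is the queue at which the server is located in slot $t$ and $C_i(t)$ is the channel state of queue $i$ ($1$ = ON, $0$ = OFF). $C_1$ and $C_2$ are independent two-state Markov chains, each changing state in every slot with probability $\epsilon$ (both from $1$ to $0$ and from $0$ to $1$), independently of the actions. The action $a_t\in\mathcal{A}=\{0,1\}$ is chosen after observing the state: $a_t=1$ (stay) gives $m(t+1)=m(t)$, and $a_t=0$ (switch) makes $m(t+1)$ the other queue. The reward functions are $\overline r_i(\mathbf{s},a)=1$ if $m=i$, $C_i=1$ and $a=1$, and $\overline r_i(\mathbf{s},a)=0$ otherwise, $i\in\{1,2\}$. Let $\mathbf{P}(\mathbf{s}|\mathbf{s}',a)$ be the transition probabilities. The state-action polytope $\mathbf{X}$ is the set of all vectors $\mathbf{x}=(\mathbf{x}(\mathbf{s},a))_{\mathbf{s}\in\mathcal S,a\in\mathcal A}$ with $\mathbf{x}(\mathbf{s},a)\ge0$, $\sum_{\mathbf{s},a}\mathbf{x}(\mathbf{s},a)=1$, and $\sum_a\mathbf{x}(\mathbf{s},a)=\sum_{\mathbf{s}'}\sum_a\mathbf{P}(\mathbf{s}|\mathbf{s}',a)\mathbf{x}(\mathbf{s}',a)$ for all $\mathbf{s}\in\mathcal{S}$. The rate region (rate polytope) is $$\mathbf{\Lambda}_s=\Big\{(r_1,r_2): r_i=\sum_{\mathbf{s},a}\mathbf{x}(\mathbf{s},a)\overline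 r_i(\mathbf{s},a),\ i=1,2,\ \mathbf{x}\in\mathbf{X}\Big\},$$ which is the set of all time average expected departure rate pairs obtainable in the saturated system under all (possibly history-dependent, randomized, non-stationary) policies. *)

theory Defs
  imports Complex_Main
begin

datatype queue = Q1 | Q2
datatype channel = OFF | ON
datatype action = Switch | Stay

lemma UNIV_queue: "(UNIV :: queue set) = {Q1, Q2}"
  using queue.exhaust by auto

lemma UNIV_channel: "(UNIV :: channel set) = {OFF, ON}"
  using channel.exhaust by auto

lemma UNIV_action: "(UNIV :: action set) = {Switch, Stay}"
  using action.exhaust by auto

instance queue :: finite by standard (simp add: UNIV_queue)
instance channel :: finite by standard (simp add: UNIV_channel)
instance action :: finite by standard (simp add: UNIV_action)

text \<open>A state \<open>(m, c1, c2)\<close> records the server location and the states of channels 1 and 2.\<close>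

type_synonym state = "queue \<times> channel \<times> channel"

fun next_queue :: "queue \<Rightarrow> action \<Rightarrow> queue" where
  "next_queue m Stay = m"
| "next_queue Q1 Switch = Q2"
| "next_queue Q2 Switch = Q1"

definition channel_prob :: "real \<Rightarrow> channel \<Rightarrow> channel \<Rightarrow> real" where
  "channel_prob \<epsilon> c c' = (if c' = c then 1 - \<epsilon> else \<epsilon>)"

text \<open>\<open>trans_prob \<epsilon> s s' a\<close> is the probability of moving to \<open>s\<close> from \<open>s'\<close> under action \<open>a\<close>:
  the target state is the first argument. The product expresses that the two channels evolve
  independently of each other and of the action.\<close>

fun trans_prob :: "real \<Rightarrow> state \<Rightarrow> state \<Rightarrow> action \<Rightarrow> real" where
  "trans_prob \<epsilon> (m, c1, c2) (m', c1', c2') a =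
     (if m = next_queue m' a then 1 else 0) * channel_prob \<epsilon> c1' c1 * channel_prob \<epsilon> c2' c2"

fun channel_of :: "queue \<Rightarrow> state \<Rightarrow> channel" where
  "channel_of Q1 (m, c1, c2) = c1"
| "channel_of Q2 (m, c1, c2) = c2"

definition reward :: "queue \<Rightarrow> state \<Rightarrow> action \<Rightarrow> real" where
  "reward i s a = (if fst s = i \<and> channel_of i s = ON \<and> a = Stay then 1 else 0)"

definition state_action_polytope ::
    "('s::finite \<Rightarrow> 's \<Rightarrow> 'a::finite \<Rightarrow> real) \<Rightarrow> ('s \<Rightarrow> 'a \<Rightarrow> real) set" where
  "state_action_polytope P = {x.
     (\<forall>s a. 0 \<le> x s a) \<and>
     (\<Sum>s\<in>UNIV. \<Sum>a\<in>UNIV. x s a) = 1 \<and>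
     (\<forall>s. (\<Sum>a\<in>UNIV. x s a) = (\<Sum>s'\<in>UNIV. \<Sum>a\<in>UNIV. P s s' a * x s' a))}"

definition avg_reward :: "(state \<Rightarrow> action \<Rightarrow> real) \<Rightarrow> queue \<Rightarrow> real" where
  "avg_reward x i = (\<Sum>s\<in>UNIV. \<Sum>a\<in>UNIV. x s a * reward i s a)"

definition rate_region :: "real \<Rightarrow> (real \<times> real) set" where
  "rate_region \<epsilon> =
     {(avg_reward x Q1, avg_reward x Q2) | x. x \<in> state_action_polytope (trans_prob \<epsilon>)}"

definition eps_crit :: real where
  "eps_crit = 1 - sqrt 2 / 2"

end

theory Submission
  imports Defs
begin

text \<open>
  The region is a polygon, and both inclusions come from a small linear program.

  Reduction. The channels evolve without regard to the server, and their only stationary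
  distribution is the uniform one, so every point \<open>x\<close> of the state-action polytope gives each of the
  four channel configurations total mass \<open>1/4\<close>. Given this, the balance equations for the states at
  queue 2 follow from those at queue 1, and four equations remain (\<open>state_action_polytope_iff\<close>).

  Outer bound. Each edge \<open>\<alpha> r1 + \<beta> r2 \<le> g\<close> is certified by linear programming duality. The dual
  variables are \<open>D c\<close>, the long-run advantage of standing at queue 1 rather than at queue 2 when the
  channels are in configuration \<open>c\<close>, and \<open>M c\<close>, the best immediate reward plus future advantage that a
  server at queue 2 can collect in configuration \<open>c\<close>. The bound that they give is the average of
  \<open>M\<close> (\<open>potential_bound\<close>). All the edges need certificates of a single two-parameter shape
  (\<open>potential_bound_parametric\<close>).

  Inner bound. Up to exchanging the queues, the corners of the polygon are rates of stationary
  deterministic policies of four kinds: switching in every slot, which gives \<open>(0, 0)\<close>; never leaving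
  queue 2, which gives \<open>(0, 1/2)\<close>; being at queue 1 only in the slot after \<open>(ON, OFF)\<close>; and leaving
  queue 1 when channel 1 is OFF but queue 2 only on \<open>(ON, OFF)\<close>. The region is convex and contains
  the origin, so it contains every triangle spanned by the origin and two achievable points
  (\<open>rate_region_triangle\<close>), and the triangles over consecutive corners fill the polygon.

  The threshold. A server at queue 1 that sees both channels ON can stay or move to queue 2. For the
  objective that belongs to the edge ending in \<open>(0, 1/2)\<close>, the sign of \<open>1 - 4 \<epsilon> + 2 \<epsilon>\<^sup>2\<close> decides which
  is better: below \<open>eps_crit\<close> moving wins, and the third policy above is an additional corner; from
  \<open>eps_crit\<close> on staying is at least as good, and that corner disappears.
\<close>

section \<open>Stationary distributions of the two channels\<close>

definition joint_prob :: "real \<Rightarrow> channel \<times> channel \<Rightarrow> channel \<times> channel \<Rightarrow> real" where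
  "joint_prob \<epsilon> c c' = channel_prob \<epsilon> (fst c) (fst c') * channel_prob \<epsilon> (snd c) (snd c')"

lemma trans_prob_joint:
  "trans_prob \<epsilon> (m, c) (m', c') a = (if m = next_queue m' a then joint_prob \<epsilon> c' c else 0)"
  by (cases c; cases c') (simp add: joint_prob_def)

lemma UNIV_channel_pair:
  "(UNIV :: (channel \<times> channel) set) = {(OFF, OFF), (OFF, ON), (ON, OFF), (ON, ON)}"
  by (auto simp: UNIV_channel simp flip: UNIV_Times_UNIV)

lemma sum_channel_pair:
  "(\<Sum>c\<in>UNIV. f c) = f (OFF, OFF) + f (OFF, ON) + f (ON, OFF) + f (ON, ON :: channel)"
  for f :: "channel \<times> channel \<Rightarrow> real"
  by (simp add: UNIV_channel_pair)

lemma all_channel_pair: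
  "(\<forall>c :: channel \<times> channel. Q c) \<longleftrightarrow> Q (OFF, OFF) \<and> Q (OFF, ON) \<and> Q (ON, OFF) \<and> Q (ON, ON)"
  using UNIV_channel_pair by (metis (full_types) UNIV_I insertE singletonD)

lemma sum_action: "(\<Sum>a\<in>UNIV. f a) = f Switch + f Stay" for f :: "action \<Rightarrow> real"
  by (simp add: UNIV_action)

lemma sum_state: "(\<Sum>s\<in>UNIV. f s) = (\<Sum>c\<in>UNIV. f (Q1, c) + f (Q2, c))"
  for f :: "state \<Rightarrow> real"
proof -
  have "(\<Sum>s\<in>UNIV. f s) = (\<Sum>m\<in>UNIV. \<Sum>c\<in>UNIV. f (m, c))"
    by (simp add: sum.cartesian_product)
  then show ?thesis
    by (simp add: UNIV_queue sum.distrib)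
qed

lemma sum_joint_prob: "(\<Sum>c'\<in>UNIV. joint_prob \<epsilon> c' c) = 1"
proof -
  have "\<forall>c. (\<Sum>c'\<in>UNIV. joint_prob \<epsilon> c' c) = 1"
    unfolding all_channel_pair sum_channel_pair
    by (simp add: joint_prob_def channel_prob_def algebra_simps)
  then show ?thesis by blast
qed

text \<open>
  The stationarity equations determine the two single-channel marginals, because \<open>\<epsilon> \<noteq> 0\<close>, and then
  the correlation, which shrinks by the factor \<open>(1 - 2 \<epsilon>)\<^sup>2\<close> per slot. This factor is less than 1 only
  when \<open>\<epsilon> \<noteq> 1\<close> as well: for \<open>\<epsilon> = 1\<close> the uniform distribution on \<open>{(ON, ON), (OFF, OFF)}\<close> is also
  stationary.
\<close>

lemma stationary_channels_uniform:
  assumes "0 < \<epsilon>" "\<epsilon> < 1"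
    and total: "(\<Sum>c\<in>UNIV. w c) = 1"
    and stat: "\<And>c. w c = (\<Sum>c'\<in>UNIV. joint_prob \<epsilon> c' c * w c')"
  shows "w c = 1/4"
proof -
  define t where "t = w (ON, ON)"
  define e where "e c = w c - (\<Sum>c'\<in>UNIV. joint_prob \<epsilon> c' c * w c')" for c
  have e: "e c = 0" for c
    using stat[of c] by (simp add: e_def)
  note expand = e_def sum_channel_pair joint_prob_def channel_prob_def
  have total': "w (OFF, OFF) + w (OFF, ON) + w (ON, OFF) + w (ON, ON) = 1"
    using total by (simp add: sum_channel_pair)
  \<comment> \<open>Adding two equations sums out one channel and leaves the balance of the other.\<close>
  have "e (ON, ON) + e (ON, OFF) = \<epsilon> * (2 * (w (ON, ON) + w (ON, OFF))
      - (w (OFF, OFF) + w (OFF, ON) + w (ON, OFF) + w (ON, ON)))"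
    by (simp add: expand algebra_simps)
  then have 1: "w (ON, OFF) = 1/2 - t"
    using \<open>0 < \<epsilon>\<close> by (simp add: e total' t_def)
  have "e (ON, ON) + e (OFF, ON) = \<epsilon> * (2 * (w (ON, ON) + w (OFF, ON))
      - (w (OFF, OFF) + w (OFF, ON) + w (ON, OFF) + w (ON, ON)))"
    by (simp add: expand algebra_simps)
  then have 2: "w (OFF, ON) = 1/2 - t"
    using \<open>0 < \<epsilon>\<close> by (simp add: e total' t_def)
  have 3: "w (OFF, OFF) = t"
    using total' 1 2 by (simp add: t_def)
  have "e (ON, ON) = \<epsilon> * (1 - \<epsilon>) * (4 * t - 1)"
    by (simp add: expand 1 2 3 algebra_simps flip: t_def)
  then have "\<epsilon> * (1 - \<epsilon>) * (4 * t - 1) = 0"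
    by (simp add: e)
  then have "t = 1/4"
    using assms(1,2) by simp
  then have "\<forall>c. w c = 1/4"
    unfolding all_channel_pair using 1 2 3 by (simp add: t_def)
  then show ?thesis by blast
qed

section \<open>The reduced polytope, and bounds by potentials\<close>

text \<open>
  Adding the balance equations of the two queues gives stationarity of the channels. So, in the
  presence of uniform channels, the balance at queue 2 is the difference of that identity and the
  balance at queue 1. The next location is queue 1 exactly after \<open>Stay\<close> at queue 1 or \<open>Switch\<close> at
  queue 2.
\<close>

lemma state_action_polytope_iff:
  assumes "0 < \<epsilon>" "\<epsilon> < 1"
  shows "x \<in> state_action_polytope (trans_prob \<epsilon>) \<longleftrightarrow>
    (\<forall>s a. 0 \<le> x s a) \<and>
    (\<forall>c. x (Q1, c) Stay + x (Q1, c) Switch + x (Q2, c) Stay + x (Q2, c) Switch = 1/4) \<and>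
    (\<forall>c. x (Q1, c) Stay + x (Q1, c) Switch =
      (\<Sum>c'\<in>UNIV. joint_prob \<epsilon> c' c * (x (Q1, c') Stay + x (Q2, c') Switch)))"
  (is "_ \<longleftrightarrow> ?nonneg \<and> ?uniform \<and> ?balance")
proof -
  have bal1: "(\<Sum>s'\<in>UNIV. \<Sum>a\<in>UNIV. trans_prob \<epsilon> (Q1, c) s' a * x s' a) =
      (\<Sum>c'\<in>UNIV. joint_prob \<epsilon> c' c * (x (Q1, c') Stay + x (Q2, c') Switch))" for c
    unfolding sum_state sum_action trans_prob_joint by (simp add: algebra_simps)
  have bal2: "(\<Sum>s'\<in>UNIV. \<Sum>a\<in>UNIV. trans_prob \<epsilon> (Q2, c) s' a * x s' a) =
      (\<Sum>c'\<in>UNIV. joint_prob \<epsilon> c' c * (x (Q2, c') Stay + x (Q1, c') Switch))" for c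
    unfolding sum_state sum_action trans_prob_joint by (simp add: algebra_simps)
  define w where
    "w c = x (Q1, c) Stay + x (Q1, c) Switch + x (Q2, c) Stay + x (Q2, c) Switch" for c
  have states: "(\<forall>s. R s) \<longleftrightarrow> (\<forall>c. R (Q1, c)) \<and> (\<forall>c. R (Q2, c))"
    for R :: "state \<Rightarrow> bool"
    by (metis queue.exhaust surj_pair)
  have split: "(\<Sum>c'\<in>UNIV. joint_prob \<epsilon> c' c * w c') =
      (\<Sum>c'\<in>UNIV. joint_prob \<epsilon> c' c * (x (Q1, c') Stay + x (Q2, c') Switch)) +
      (\<Sum>c'\<in>UNIV. joint_prob \<epsilon> c' c * (x (Q2, c') Stay + x (Q1, c') Switch))" for c
    by (simp add: w_def algebra_simps flip: sum.distrib)
  have total: "(\<Sum>s\<in>UNIV. \<Sum>a\<in>UNIV. x s a) = (\<Sum>c\<in>UNIV. w c)"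
    unfolding sum_state sum_action w_def by (simp add: algebra_simps)
  show ?thesis
  proof
    assume "x \<in> state_action_polytope (trans_prob \<epsilon>)"
    then have nonneg: ?nonneg and one: "(\<Sum>c\<in>UNIV. w c) = 1"
      and st: "\<forall>s. x s Switch + x s Stay =
        (\<Sum>s'\<in>UNIV. \<Sum>a\<in>UNIV. trans_prob \<epsilon> s s' a * x s' a)"
      unfolding state_action_polytope_def mem_Collect_eq total
      by (simp_all add: sum_action del: split_paired_All)
    have b1: ?balance
      using st by (simp add: states bal1 add.commute del: split_paired_All)
    have b2: "\<And>c. x (Q2, c) Stay + x (Q2, c) Switch =
        (\<Sum>c'\<in>UNIV. joint_prob \<epsilon> c' c * (x (Q2, c') Stay + x (Q1, c') Switch))"
      using st by (simp add: states bal2 add.commute del: split_paired_All)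
    have "w c = (\<Sum>c'\<in>UNIV. joint_prob \<epsilon> c' c * w c')" for c
      using b1[rule_format, of c] b2[of c] unfolding split by (simp add: w_def)
    then have "w c = 1/4" for c
      using stationary_channels_uniform[OF assms one] by blast
    then show "?nonneg \<and> ?uniform \<and> ?balance"
      using nonneg b1 unfolding w_def by blast
  next
    assume asm: "?nonneg \<and> ?uniform \<and> ?balance"
    then have w: "w c = 1/4" for c
      unfolding w_def by blast
    have b1: "\<And>c. x (Q1, c) Stay + x (Q1, c) Switch =
        (\<Sum>c'\<in>UNIV. joint_prob \<epsilon> c' c * (x (Q1, c') Stay + x (Q2, c') Switch))"
      using asm by blast
    have "(\<Sum>c'\<in>UNIV. joint_prob \<epsilon> c' c * w c') = w c" for c
      unfolding w sum_distrib_right[symmetric] sum_joint_prob by simp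
    then have b2: "x (Q2, c) Stay + x (Q2, c) Switch =
        (\<Sum>c'\<in>UNIV. joint_prob \<epsilon> c' c * (x (Q2, c') Stay + x (Q1, c') Switch))" for c
      using b1[of c] split[of c] by (simp add: w_def)
    show "x \<in> state_action_polytope (trans_prob \<epsilon>)"
      unfolding state_action_polytope_def mem_Collect_eq total
    proof (intro conjI)
      show "\<forall>s a. 0 \<le> x s a"
        using asm by blast
      show "(\<Sum>c\<in>UNIV. w c) = 1"
        unfolding w sum_channel_pair by simp
      show "\<forall>s. (\<Sum>a\<in>UNIV. x s a) = (\<Sum>s'\<in>UNIV. \<Sum>a\<in>UNIV. trans_prob \<epsilon> s s' a * x s' a)"
        unfolding states bal1 bal2 b1[symmetric] b2[symmetric]
        unfolding sum_action by (simp add: add.commute)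
    qed
  qed
qed

lemma avg_reward_eq:
  "avg_reward x Q1 = (\<Sum>c\<in>UNIV. if fst c = ON then x (Q1, c) Stay else 0)"
  "avg_reward x Q2 = (\<Sum>c\<in>UNIV. if snd c = ON then x (Q2, c) Stay else 0)"
  unfolding avg_reward_def sum_state sum_action
  by (auto simp: reward_def intro!: sum.cong)

text \<open>
  Weak duality for the reduced polytope. Weighting the balance equations at queue 1 by \<open>D\<close> shows that
  collecting, in each slot, the expected advantage \<open>\<Sum>c'. joint_prob \<epsilon> c c' * D c'\<close> for moving on to
  queue 1, while paying \<open>D c\<close> for being there, changes no long-run average. After this change, the
  four premises say that none of the four location-action pairs earns more than \<open>M c\<close> in
  configuration \<open>c\<close>, and each configuration has mass \<open>1/4\<close>.
\<close>

lemma potential_bound: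
  assumes "0 < \<epsilon>" "\<epsilon> < 1" and r: "(r1, r2) \<in> rate_region \<epsilon>"
    and stay2: "\<And>c. (if snd c = ON then \<beta> else 0) \<le> M c"
    and switch2: "\<And>c. (\<Sum>c'\<in>UNIV. joint_prob \<epsilon> c c' * D c') \<le> M c"
    and stay1: "\<And>c. (if fst c = ON then \<alpha> else 0) + (\<Sum>c'\<in>UNIV. joint_prob \<epsilon> c c' * D c') \<le> M c + D c"
    and switch1: "\<And>c. 0 \<le> M c + D c"
  shows "\<alpha> * r1 + \<beta> * r2 \<le> (\<Sum>c\<in>UNIV. M c) / 4"
proof -
  obtain x where x: "x \<in> state_action_polytope (trans_prob \<epsilon>)"
    and r1: "r1 = avg_reward x Q1" and r2: "r2 = avg_reward x Q2"
    using r by (auto simp: rate_region_def)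
  define d where "d c = (\<Sum>c'\<in>UNIV. joint_prob \<epsilon> c c' * D c')" for c
  define u where "u c = x (Q1, c) Stay + x (Q2, c) Switch" for c
  have nonneg: "\<And>s a. 0 \<le> x s a"
    and unif: "\<And>c. x (Q1, c) Stay + x (Q1, c) Switch + x (Q2, c) Stay + x (Q2, c) Switch = 1/4"
    and bal: "\<And>c. x (Q1, c) Stay + x (Q1, c) Switch = (\<Sum>c'\<in>UNIV. joint_prob \<epsilon> c' c * u c')"
    using x unfolding state_action_polytope_iff[OF assms(1,2)] u_def by blast+
  have "(\<Sum>c\<in>UNIV. D c * (x (Q1, c) Stay + x (Q1, c) Switch)) =
      (\<Sum>c\<in>UNIV. \<Sum>c'\<in>UNIV. joint_prob \<epsilon> c' c * D c * u c')"
    by (simp add: bal sum_distrib_left mult_ac)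
  also have "\<dots> = (\<Sum>c\<in>UNIV. d c * u c)"
    by (subst sum.swap) (simp add: d_def sum_distrib_right)
  finally have drift: "(\<Sum>c\<in>UNIV. D c * (x (Q1, c) Stay + x (Q1, c) Switch)) = (\<Sum>c\<in>UNIV. d c * u c)" .
  have "\<alpha> * r1 + \<beta> * r2 = (\<Sum>c\<in>UNIV.
      (if fst c = ON then \<alpha> else 0) * x (Q1, c) Stay +
      (if snd c = ON then \<beta> else 0) * x (Q2, c) Stay)"
    unfolding r1 r2 avg_reward_eq sum_distrib_left sum.distrib[symmetric]
    by (auto intro!: sum.cong)
  also have "\<dots> = (\<Sum>c\<in>UNIV.
      (if fst c = ON then \<alpha> else 0) * x (Q1, c) Stay +
      (if snd c = ON then \<beta> else 0) * x (Q2, c) Stay +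
      d c * u c - D c * (x (Q1, c) Stay + x (Q1, c) Switch))"
    by (simp add: sum.distrib sum_subtractf drift)
  also have "\<dots> = (\<Sum>c\<in>UNIV.
      ((if fst c = ON then \<alpha> else 0) + d c - D c) * x (Q1, c) Stay +
      (- D c) * x (Q1, c) Switch +
      (if snd c = ON then \<beta> else 0) * x (Q2, c) Stay +
      d c * x (Q2, c) Switch)"
    by (simp add: u_def algebra_simps)
  also have "\<dots> \<le> (\<Sum>c\<in>UNIV. M c * x (Q1, c) Stay + M c * x (Q1, c) Switch +
      M c * x (Q2, c) Stay + M c * x (Q2, c) Switch)"
  proof (intro sum_mono add_mono mult_right_mono nonneg)
    fix c
    show "(if fst c = ON then \<alpha> else 0) + d c - D c \<le> M c"
      using stay1[of c] by (simp add: d_def)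
    show "- D c \<le> M c"
      using switch1[of c] by simp
  qed (use stay2 switch2 in \<open>simp_all add: d_def\<close>)
  also have "\<dots> = (\<Sum>c\<in>UNIV. M c * (1/4))"
    unfolding distrib_left[symmetric] unif ..
  finally show ?thesis
    by (simp add: sum_divide_distrib)
qed

section \<open>Symmetry and convexity of the rate region\<close>

fun swap_state :: "state \<Rightarrow> state" where
  "swap_state (m, c1, c2) = (next_queue m Switch, c2, c1)"

lemma swap_swap_state [simp]: "swap_state (swap_state s) = s"
  by (cases s rule: swap_state.cases; case_tac m) auto

lemma bij_swap_state: "bij swap_state"
  by (rule o_bij[of swap_state]) (auto simp: fun_eq_iff)

lemma sum_swap_state: "(\<Sum>s\<in>UNIV. f (swap_state s)) = (\<Sum>s\<in>UNIV. f s)"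
  for f :: "state \<Rightarrow> real"
  by (rule sum.reindex_bij_betw[OF bij_swap_state])

lemma trans_prob_swap_state: "trans_prob \<epsilon> (swap_state s) (swap_state s') a = trans_prob \<epsilon> s s' a"
proof -
  obtain m c1 c2 m' c1' c2' where "s = (m, c1, c2)" "s' = (m', c1', c2')"
    by (metis surj_pair)
  then show ?thesis
    by (cases m; cases m'; cases a) simp_all
qed

lemma reward_swap_state:
  "reward Q1 (swap_state s) a = reward Q2 s a" "reward Q2 (swap_state s) a = reward Q1 s a"
  by (cases s rule: swap_state.cases; case_tac m; simp add: reward_def)+

lemma rate_region_swap:
  assumes "(r1, r2) \<in> rate_region \<epsilon>"
  shows "(r2, r1) \<in> rate_region \<epsilon>"
proof -
  obtain x where x: "x \<in> state_action_polytope (trans_prob \<epsilon>)"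
    and r: "r1 = avg_reward x Q1" "r2 = avg_reward x Q2"
    using assms by (auto simp: rate_region_def)
  define y where "y s = x (swap_state s)" for s
  have total: "(\<Sum>s\<in>UNIV. \<Sum>a\<in>UNIV. y s a) = (\<Sum>s\<in>UNIV. \<Sum>a\<in>UNIV. x s a)"
    unfolding y_def by (rule sum_swap_state)
  have bal: "(\<Sum>s'\<in>UNIV. \<Sum>a\<in>UNIV. trans_prob \<epsilon> s s' a * y s' a) =
      (\<Sum>s'\<in>UNIV. \<Sum>a\<in>UNIV. trans_prob \<epsilon> (swap_state s) s' a * x s' a)" for s
    unfolding y_def
    by (subst sum_swap_state[symmetric]) (simp add: trans_prob_swap_state)
  have "y \<in> state_action_polytope (trans_prob \<epsilon>)"
    using x unfolding state_action_polytope_def mem_Collect_eq total bal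
    by (simp add: y_def)
  moreover have "avg_reward y Q1 = r2" "avg_reward y Q2 = r1"
    unfolding r avg_reward_def
    by (subst sum_swap_state[symmetric], simp add: y_def reward_swap_state)+
  ultimately show ?thesis
    by (auto simp: rate_region_def)
qed

lemma rate_region_convex:
  assumes v: "(v1, v2) \<in> rate_region \<epsilon>" and w: "(w1, w2) \<in> rate_region \<epsilon>"
    and ab: "0 \<le> a" "0 \<le> b" "a + b = 1"
  shows "(a * v1 + b * w1, a * v2 + b * w2) \<in> rate_region \<epsilon>"
proof -
  obtain x where x: "x \<in> state_action_polytope (trans_prob \<epsilon>)"
    and v12: "v1 = avg_reward x Q1" "v2 = avg_reward x Q2"
    using v by (auto simp: rate_region_def)
  obtain y where y: "y \<in> state_action_polytope (trans_prob \<epsilon>)"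
    and w12: "w1 = avg_reward y Q1" "w2 = avg_reward y Q2"
    using w by (auto simp: rate_region_def)
  define z where "z s t = a * x s t + b * y s t" for s t
  have lin: "(\<Sum>s\<in>UNIV. \<Sum>t\<in>UNIV. f s t * z s t) =
      a * (\<Sum>s\<in>UNIV. \<Sum>t\<in>UNIV. f s t * x s t) + b * (\<Sum>s\<in>UNIV. \<Sum>t\<in>UNIV. f s t * y s t)"
    for f :: "state \<Rightarrow> action \<Rightarrow> real"
    by (simp add: z_def sum_distrib_left algebra_simps flip: sum.distrib)
  have "z \<in> state_action_polytope (trans_prob \<epsilon>)"
    unfolding state_action_polytope_def mem_Collect_eq
  proof (intro conjI allI)
    fix s t show "0 \<le> z s t"
      using x y ab by (simp add: z_def state_action_polytope_def del: split_paired_All)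
  next
    show "(\<Sum>s\<in>UNIV. \<Sum>t\<in>UNIV. z s t) = 1"
      using lin[of "\<lambda>_ _. 1"] x y ab by (simp add: state_action_polytope_def)
  next
    fix s
    have "(\<Sum>t\<in>UNIV. z s t) = a * (\<Sum>t\<in>UNIV. x s t) + b * (\<Sum>t\<in>UNIV. y s t)"
      by (simp add: z_def sum_distrib_left sum.distrib)
    then show "(\<Sum>t\<in>UNIV. z s t) = (\<Sum>s'\<in>UNIV. \<Sum>t\<in>UNIV. trans_prob \<epsilon> s s' t * z s' t)"
      using lin[of "trans_prob \<epsilon> s"] x y
      by (simp add: state_action_polytope_def del: split_paired_All)
  qed
  moreover have "avg_reward z i = a * avg_reward x i + b * avg_reward y i" for i
    using lin[of "reward i"] by (simp add: avg_reward_def mult.commute)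
  ultimately show ?thesis
    unfolding rate_region_def v12 w12 mem_Collect_eq by metis
qed

lemma rate_region_nonneg:
  assumes "(r1, r2) \<in> rate_region \<epsilon>"
  shows "0 \<le> r1" "0 \<le> r2"
  using assms
  by (auto simp: rate_region_def avg_reward_def reward_def state_action_polytope_def
      intro!: sum_nonneg)

section \<open>Rates of stationary deterministic policies\<close>

text \<open>
  A policy is given by the configurations after which the next location is queue 1: \<open>A\<close> when the
  server is now at queue 1, so that it stays, and \<open>B\<close> when it is now at queue 2, so that it switches.
  The stationary probability of being at queue 1 in configuration \<open>c\<close> is \<open>p c\<close>, which leaves
  \<open>1/4 - p c\<close> for queue 2.
\<close>

lemma deterministic_policy_rates:
  assumes "0 < \<epsilon>" "\<epsilon> < 1"
    and p: "\<And>c. 0 \<le> p c" "\<And>c. p c \<le> 1/4"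
    and bal: "\<And>c. p c = (\<Sum>c'\<in>UNIV. joint_prob \<epsilon> c' c *
      ((if c' \<in> A then p c' else 0) + (if c' \<in> B then 1/4 - p c' else 0)))"
    and r1: "r1 = (\<Sum>c\<in>UNIV. if fst c = ON \<and> c \<in> A then p c else 0)"
    and r2: "r2 = (\<Sum>c\<in>UNIV. if snd c = ON \<and> c \<notin> B then 1/4 - p c else 0)"
  shows "(r1, r2) \<in> rate_region \<epsilon>"
proof -
  define x :: "state \<Rightarrow> action \<Rightarrow> real" where
    "x s a = (case s of
        (Q1, c) \<Rightarrow> if (a = Stay) = (c \<in> A) then p c else 0
      | (Q2, c) \<Rightarrow> if (a = Switch) = (c \<in> B) then 1/4 - p c else 0)" for s a
  have x1: "x (Q1, c) Stay = (if c \<in> A then p c else 0)"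
    "x (Q1, c) Switch = (if c \<in> A then 0 else p c)"
    "x (Q2, c) Stay = (if c \<in> B then 0 else 1/4 - p c)"
    "x (Q2, c) Switch = (if c \<in> B then 1/4 - p c else 0)" for c
    by (simp_all add: x_def)
  have "x \<in> state_action_polytope (trans_prob \<epsilon>)"
    unfolding state_action_polytope_iff[OF assms(1,2)]
  proof (intro conjI allI)
    fix s a show "0 \<le> x s a"
      using p by (auto simp: x_def split: prod.splits queue.splits)
  next
    fix c
    show "x (Q1, c) Stay + x (Q1, c) Switch =
      (\<Sum>c'\<in>UNIV. joint_prob \<epsilon> c' c * (x (Q1, c') Stay + x (Q2, c') Switch))"
      unfolding x1 using bal[of c] by simp
  qed (simp add: x1)
  moreover have "avg_reward x Q1 = r1" "avg_reward x Q2 = r2"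
    unfolding avg_reward_eq r1 r2 x1 by (auto intro!: sum.cong)
  ultimately show ?thesis
    by (auto simp: rate_region_def)
qed

text \<open>The policy that switches in every slot.\<close>

lemma idle_in_rate_region:
  assumes "0 < \<epsilon>" "\<epsilon> < 1" shows "(0, 0) \<in> rate_region \<epsilon>"
  by (rule deterministic_policy_rates[OF assms, where p = "\<lambda>_. 1/8" and A = "{}" and B = UNIV])
    (simp_all add: sum_joint_prob flip: sum_divide_distrib)

lemma never_switch_in_rate_region:
  assumes "0 < \<epsilon>" "\<epsilon> < 1" shows "(0, 1/2) \<in> rate_region \<epsilon>"
  by (rule deterministic_policy_rates[OF assms, where p = "\<lambda>_. 0" and A = "{}" and B = "{}"])
    (simp_all add: sum_channel_pair)

text \<open>
  Whatever its location, the server goes to queue 1 precisely when it observes \<open>(ON, OFF)\<close>, so its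
  location in a slot depends only on the previous channels.
\<close>

lemma prefer_queue2_in_rate_region:
  assumes "0 < \<epsilon>" "\<epsilon> < 1"
  shows "((1 - \<epsilon>)^2 / 4, 1/2 - \<epsilon>/4) \<in> rate_region \<epsilon>"
proof (rule deterministic_policy_rates[OF assms, where A = "{(ON, OFF)}" and B = "{(ON, OFF)}"
      and p = "\<lambda>c. joint_prob \<epsilon> (ON, OFF) c / 4"])
  fix c
  show "0 \<le> joint_prob \<epsilon> (ON, OFF) c / 4"
    using assms by (simp add: joint_prob_def channel_prob_def)
  have "joint_prob \<epsilon> (ON, OFF) c \<le> 1 * 1"
    unfolding joint_prob_def
    by (rule mult_mono) (use assms in \<open>simp_all add: channel_prob_def\<close>)
  then show "joint_prob \<epsilon> (ON, OFF) c / 4 \<le> 1/4"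
    by simp
qed (simp_all add: sum_channel_pair joint_prob_def channel_prob_def power2_eq_square field_simps)

text \<open>
  The server stays at queue 1 while channel 1 is ON, and leaves queue 2 only on \<open>(ON, OFF)\<close>. The two
  locations lead to different decisions in \<open>(ON, ON)\<close> only, so the stationary equations reduce to a
  single unknown \<open>q\<close>, the probability of being at queue 1 with both channels ON.
\<close>

lemma follow_channels_in_rate_region:
  assumes "0 < \<epsilon>" "\<epsilon> < 1"
  shows "((1 - \<epsilon>) * (3 - 2*\<epsilon>) / (4 * (2 - \<epsilon>)), (3 - 2*\<epsilon>) / (4 * (2 - \<epsilon>))) \<in> rate_region \<epsilon>"
proof -
  define t where "t = 1 / (4 * (2 - \<epsilon>))"
  define q where "q = (1 - \<epsilon>) * t"
  have t: "4 * t * (2 - \<epsilon>) = 1"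
    using assms by (simp add: t_def)
  have q: "0 \<le> q" "q \<le> 1/4"
    using assms by (simp_all add: q_def t_def field_simps)
  have eq: "4 * q * (2 - \<epsilon>) = 1 - \<epsilon>"
    unfolding q_def using t by (metis mult.assoc mult.commute mult_1)
  \<comment> \<open>the fixed point equation that determines \<open>q\<close>\<close>
  have fix11: "\<epsilon> * (1 - \<epsilon>) / 4 + (1 - \<epsilon>)^2 * q = q"
  proof -
    have "q - (\<epsilon> * (1 - \<epsilon>) / 4 + (1 - \<epsilon>)^2 * q) = \<epsilon> / 4 * (4 * q * (2 - \<epsilon>) - (1 - \<epsilon>))"
      by (simp add: power2_eq_square field_simps)
    then show ?thesis by (simp add: eq)
  qed
  define p where "p c = joint_prob \<epsilon> (ON, OFF) c / 4 + joint_prob \<epsilon> (ON, ON) c * q" for c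
  have p: "p (ON, ON) = q" "p (ON, OFF) = (1 - \<epsilon>)^2 / 4 + \<epsilon> * (1 - \<epsilon>) * q"
    "p (OFF, ON) = \<epsilon>^2 / 4 + \<epsilon> * (1 - \<epsilon>) * q"
    using fix11 by (simp_all add: p_def joint_prob_def channel_prob_def power2_eq_square mult_ac)
  have J: "0 \<le> joint_prob \<epsilon> c' c" for c c'
    using assms by (simp add: joint_prob_def channel_prob_def)
  have "(1 - \<epsilon>)^2 / 4 + \<epsilon> * (1 - \<epsilon>) * q + q - (3 - 2*\<epsilon>) * q =
      (1 - \<epsilon>) / 4 * ((1 - \<epsilon>) - 4 * q * (2 - \<epsilon>))"
    by (simp add: power2_eq_square field_simps)
  then have "(3 - 2*\<epsilon>) * q = p (ON, OFF) + p (ON, ON)"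
    by (simp add: eq p)
  then have r1: "(1 - \<epsilon>) * (3 - 2*\<epsilon>) / (4 * (2 - \<epsilon>)) = p (ON, OFF) + p (ON, ON)"
    by (simp add: q_def t_def mult_ac)
  have "1/2 - \<epsilon>^2 / 4 - \<epsilon> * (1 - \<epsilon>) * q - q - (3 - 2*\<epsilon>) * t =
      (2 - \<epsilon>^2) / 4 * (1 - 4 * t * (2 - \<epsilon>))"
    by (simp add: q_def power2_eq_square field_simps)
  then have r2: "(3 - 2*\<epsilon>) / (4 * (2 - \<epsilon>)) = (1/4 - p (OFF, ON)) + (1/4 - p (ON, ON))"
    unfolding t p by (simp add: t_def)
  show ?thesis
  proof (rule deterministic_policy_rates[OF assms,
        where A = "{(ON, OFF), (ON, ON)}" and B = "{(ON, OFF)}" and p = p])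
    fix c
    show "0 \<le> p c"
      using J q by (simp add: p_def)
    have "joint_prob \<epsilon> (ON, ON) c * q \<le> joint_prob \<epsilon> (ON, ON) c * (1/4)"
      by (rule mult_left_mono) (use J q in auto)
    moreover have "joint_prob \<epsilon> (ON, OFF) c + joint_prob \<epsilon> (ON, ON) c \<le> 1"
      using sum_joint_prob[of \<epsilon> c] J[of "(OFF, OFF)" c] J[of "(OFF, ON)" c]
      unfolding sum_channel_pair by linarith
    ultimately show "p c \<le> 1/4"
      unfolding p_def by linarith
    show "p c = (\<Sum>c'\<in>UNIV. joint_prob \<epsilon> c' c *
      ((if c' \<in> {(ON, OFF), (ON, ON)} then p c' else 0) + (if c' \<in> {(ON, OFF)} then 1/4 - p c' else 0)))"
      unfolding sum_channel_pair by (simp add: p(1)) (simp add: p_def)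
  qed (unfold r1 r2, simp_all add: sum_channel_pair)
qed

section \<open>The inner bound\<close>

text \<open>
  The cone conditions give \<open>r = a v + b w\<close> with \<open>a, b \<ge> 0\<close> by Cramer's rule. Since \<open>v\<close> and \<open>w\<close> lie on the
  line of level \<open>g\<close>, the linear form takes the value \<open>(a + b) g\<close> at \<open>r\<close>, hence \<open>a + b \<le> 1\<close>, and the
  origin takes up the remaining weight.
\<close>

lemma rate_region_triangle:
  assumes "0 < \<epsilon>" "\<epsilon> < 1"
    and v: "(v1, v2) \<in> rate_region \<epsilon>" "\<alpha> * v1 + \<beta> * v2 = g"
    and w: "(w1, w2) \<in> rate_region \<epsilon>" "\<alpha> * w1 + \<beta> * w2 = g"
    and g: "0 < g" "\<alpha> * r1 + \<beta> * r2 \<le> g"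
    and det: "0 < v1 * w2 - v2 * w1"
    and cone: "r2 * w1 \<le> r1 * w2" "v2 * r1 \<le> v1 * r2"
  shows "(r1, r2) \<in> rate_region \<epsilon>"
proof -
  define \<Delta> where "\<Delta> = v1 * w2 - v2 * w1"
  define a where "a = (r1 * w2 - r2 * w1) / \<Delta>"
  define b where "b = (v1 * r2 - v2 * r1) / \<Delta>"
  have \<Delta>: "0 < \<Delta>"
    using det by (simp add: \<Delta>_def)
  have ab: "0 \<le> a" "0 \<le> b"
    using cone \<Delta> by (simp_all add: a_def b_def)
  have aD: "a * \<Delta> = r1 * w2 - r2 * w1" and bD: "b * \<Delta> = v1 * r2 - v2 * r1"
    using \<Delta> by (simp_all add: a_def b_def)
  have "(a * v1 + b * w1) * \<Delta> = r1 * \<Delta>"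
    using aD bD by (simp add: algebra_simps \<Delta>_def) algebra
  then have r1: "r1 = a * v1 + b * w1"
    using \<Delta> by simp
  have "(a * v2 + b * w2) * \<Delta> = r2 * \<Delta>"
    using aD bD by (simp add: algebra_simps \<Delta>_def) algebra
  then have r2: "r2 = a * v2 + b * w2"
    using \<Delta> by simp
  have "\<alpha> * r1 + \<beta> * r2 = a * (\<alpha> * v1 + \<beta> * v2) + b * (\<alpha> * w1 + \<beta> * w2)"
    unfolding r1 r2 by (simp add: algebra_simps)
  then have "\<alpha> * r1 + \<beta> * r2 = (a + b) * g"
    unfolding v(2) w(2) by (simp add: distrib_right)
  then have le1: "a + b \<le> 1"
    using g mult_le_cancel_right_pos[of g "a + b" 1] by simp
  show ?thesis
  proof (cases "a + b = 0")
    case True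
    then have "a = 0" "b = 0" using ab by auto
    then show ?thesis
      using idle_in_rate_region[OF assms(1,2)] by (simp add: r1 r2)
  next
    case False
    then have pos: "0 < a + b" using ab by linarith
    have "(a / (a + b) * v1 + b / (a + b) * w1, a / (a + b) * v2 + b / (a + b) * w2) \<in> rate_region \<epsilon>"
      by (rule rate_region_convex[OF v(1) w(1)])
        (use ab pos in \<open>simp_all flip: add_divide_distrib\<close>)
    from rate_region_convex[OF this idle_in_rate_region[OF assms(1,2)], of "a + b" "1 - (a + b)"]
    have "((a + b) * (a / (a + b) * v1 + b / (a + b) * w1),
        (a + b) * (a / (a + b) * v2 + b / (a + b) * w2)) \<in> rate_region \<epsilon>"
      using pos le1 by simp
    moreover have "(a + b) * (a / (a + b) * v1 + b / (a + b) * w1) = r1"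
      "(a + b) * (a / (a + b) * v2 + b / (a + b) * w2) = r2"
      using pos by (simp_all add: r1 r2 distrib_left)
    ultimately show ?thesis by simp
  qed
qed



text \<open>The triangle around the diagonal, whose outer corners come from the channel-following policy and
  its mirror image.\<close>

lemma balanced_sector_achievable:
  assumes \<epsilon>: "0 < \<epsilon>" "\<epsilon> < 1"
    and "(1 - \<epsilon>) * r2 \<le> r1" "(1 - \<epsilon>) * r1 \<le> r2" "r1 + r2 \<le> 3/4 - \<epsilon>/2"
  shows "(r1, r2) \<in> rate_region \<epsilon>"
proof -
  define s where "s = (3 - 2*\<epsilon>) / (4 * (2 - \<epsilon>))"
  have s: "0 < s" "s * (2 - \<epsilon>) = 3/4 - \<epsilon>/2"
    using \<epsilon> by (simp_all add: s_def field_simps)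
  have w: "((1 - \<epsilon>) * s, s) \<in> rate_region \<epsilon>"
    using follow_channels_in_rate_region[OF \<epsilon>] by (simp add: s_def)
  note v = rate_region_swap[OF w]
  show ?thesis
  proof (rule rate_region_triangle[OF \<epsilon> v _ w, where \<alpha> = 1 and \<beta> = 1 and g = "3/4 - \<epsilon>/2"])
    have "0 < s * s * (\<epsilon> * (2 - \<epsilon>))"
      using s \<epsilon> by simp
    then show "0 < s * s - (1 - \<epsilon>) * s * ((1 - \<epsilon>) * s)"
      by (simp add: algebra_simps)
    have "s * ((1 - \<epsilon>) * r2) \<le> s * r1" "s * ((1 - \<epsilon>) * r1) \<le> s * r2"
      using assms s by (auto intro: mult_left_mono)
    then show "r2 * ((1 - \<epsilon>) * s) \<le> r1 * s" "(1 - \<epsilon>) * s * r1 \<le> s * r2"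
      by (simp_all add: mult_ac)
  qed (use s assms in \<open>simp_all add: algebra_simps\<close>)
qed

text \<open>
  The half \<open>r1 \<le> r2\<close> of the polygon is cut into three sectors by the rays through the corners
  \<open>((1 - \<epsilon>) s, s)\<close>, where \<open>s = (3 - 2 \<epsilon>) / (4 (2 - \<epsilon>))\<close>, and \<open>((1 - \<epsilon>)\<^sup>2 / 4, (2 - \<epsilon>) / 4)\<close>. Each of the
  three edges closes one sector.
\<close>

lemma slow_channel_achievable:
  assumes \<epsilon>: "0 < \<epsilon>" "\<epsilon> < 1" and r: "0 \<le> r1" "r1 \<le> r2"
    and bounds: "\<epsilon> * r1 + (1 - \<epsilon>)^2 * r2 \<le> (1 - \<epsilon>)^2 / 2"
      "(1 - \<epsilon>) * r1 + (1 + \<epsilon> - \<epsilon>^2) * r2 \<le> 3/4 - \<epsilon>/2"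
      "r1 + r2 \<le> 3/4 - \<epsilon>/2"
  shows "(r1, r2) \<in> rate_region \<epsilon>"
proof -
  define s where "s = (3 - 2*\<epsilon>) / (4 * (2 - \<epsilon>))"
  have s: "0 < s" "s * (2 - \<epsilon>) = 3/4 - \<epsilon>/2"
    using \<epsilon> by (simp_all add: s_def field_simps)
  have v: "((1 - \<epsilon>) * s, s) \<in> rate_region \<epsilon>"
    using follow_channels_in_rate_region[OF \<epsilon>] by (simp add: s_def)
  note w = prefer_queue2_in_rate_region[OF \<epsilon>]
  have "(1 - \<epsilon>) * r1 \<le> 1 * r1"
    by (rule mult_right_mono) (use \<epsilon> r in auto)
  then have le: "(1 - \<epsilon>) * r1 \<le> r2"
    using r by simp
  consider "(1 - \<epsilon>) * r2 \<le> r1"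
    | "r1 \<le> (1 - \<epsilon>) * r2" "(1 - \<epsilon>)^2 * r2 \<le> (2 - \<epsilon>) * r1"
    | "(2 - \<epsilon>) * r1 \<le> (1 - \<epsilon>)^2 * r2"
    by linarith
  then show ?thesis
  proof cases
    case 1
    then show ?thesis
      using balanced_sector_achievable[OF \<epsilon>] le bounds by blast
  next
    case 2
    show ?thesis
    proof (rule rate_region_triangle[OF \<epsilon> v _ w _ _ bounds(2)])
      have "(1 - \<epsilon>) * ((1 - \<epsilon>) * s) + (1 + \<epsilon> - \<epsilon>^2) * s = s * (2 - \<epsilon>)"
        by (simp add: power2_eq_square algebra_simps)
      then show "(1 - \<epsilon>) * ((1 - \<epsilon>) * s) + (1 + \<epsilon> - \<epsilon>^2) * s = 3/4 - \<epsilon>/2"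
        using s by simp
      show "(1 - \<epsilon>) * ((1 - \<epsilon>)^2 / 4) + (1 + \<epsilon> - \<epsilon>^2) * (1/2 - \<epsilon>/4) = 3/4 - \<epsilon>/2"
        by (simp add: power2_eq_square field_simps)
      have "0 < (1 - \<epsilon>) * s / 4"
        using s \<epsilon> by simp
      then show "0 < (1 - \<epsilon>) * s * (1/2 - \<epsilon>/4) - s * ((1 - \<epsilon>)^2 / 4)"
        by (simp add: power2_eq_square field_simps)
      show "r2 * ((1 - \<epsilon>)^2 / 4) \<le> r1 * (1/2 - \<epsilon>/4)"
        using 2(2) by (simp add: field_simps)
      have "s * r1 \<le> s * ((1 - \<epsilon>) * r2)"
        by (rule mult_left_mono) (use 2 s in auto)
      then show "s * r1 \<le> (1 - \<epsilon>) * s * r2"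
        by (simp add: mult_ac)
    qed (use \<epsilon> in simp)
  next
    case 3
    show ?thesis
    proof (rule rate_region_triangle[OF \<epsilon> w _ never_switch_in_rate_region[OF \<epsilon>] _ _ bounds(1)])
      show "\<epsilon> * ((1 - \<epsilon>)^2 / 4) + (1 - \<epsilon>)^2 * (1/2 - \<epsilon>/4) = (1 - \<epsilon>)^2 / 2"
        by (simp add: field_simps)
      show "(1/2 - \<epsilon>/4) * r1 \<le> (1 - \<epsilon>)^2 / 4 * r2"
        using 3 by (simp add: field_simps)
    qed (use \<epsilon> r in simp_all)
  qed
qed

text \<open>
  Here the edge from \<open>((1 - \<epsilon>) s, s)\<close>, where \<open>s = (3 - 2 \<epsilon>) / (4 (2 - \<epsilon>))\<close>, goes straight to \<open>(0, 1/2)\<close>, without an intermediate corner.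
\<close>

lemma fast_channel_achievable:
  assumes \<epsilon>: "0 < \<epsilon>" "\<epsilon> < 1" and r: "0 \<le> r1" "r1 \<le> r2"
    and bounds: "r1 + (1 - \<epsilon>) * (3 - 2*\<epsilon>) * r2 \<le> (1 - \<epsilon>) * (3 - 2*\<epsilon>) / 2"
      "r1 + r2 \<le> 3/4 - \<epsilon>/2"
  shows "(r1, r2) \<in> rate_region \<epsilon>"
proof (cases "(1 - \<epsilon>) * r2 \<le> r1")
  case True
  have "(1 - \<epsilon>) * r1 \<le> 1 * r1"
    by (rule mult_right_mono) (use \<epsilon> r in auto)
  then show ?thesis
    using balanced_sector_achievable[OF \<epsilon> True _ bounds(2)] r by simp
next
  case False
  define s where "s = (3 - 2*\<epsilon>) / (4 * (2 - \<epsilon>))"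
  have s: "0 < s" "4 * (s * (2 - \<epsilon>)) = 3 - 2*\<epsilon>"
    using \<epsilon> by (simp_all add: s_def field_simps)
  have v: "((1 - \<epsilon>) * s, s) \<in> rate_region \<epsilon>"
    using follow_channels_in_rate_region[OF \<epsilon>] by (simp add: s_def)
  have bound: "1 * r1 + (1 - \<epsilon>) * (3 - 2*\<epsilon>) * r2 \<le> (1 - \<epsilon>) * (3 - 2*\<epsilon>) / 2"
    using bounds by simp
  show ?thesis
  proof (rule rate_region_triangle[OF \<epsilon> v _ never_switch_in_rate_region[OF \<epsilon>] _ _ bound])
    have "1 * ((1 - \<epsilon>) * s) + (1 - \<epsilon>) * (3 - 2*\<epsilon>) * s = (1 - \<epsilon>) * (4 * (s * (2 - \<epsilon>))) / 2"
      by (simp add: field_simps)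
    then show "1 * ((1 - \<epsilon>) * s) + (1 - \<epsilon>) * (3 - 2*\<epsilon>) * s = (1 - \<epsilon>) * (3 - 2*\<epsilon>) / 2"
      by (simp only: s)
    have "s * r1 \<le> s * ((1 - \<epsilon>) * r2)"
      by (rule mult_left_mono) (use False s in auto)
    then show "s * r1 \<le> (1 - \<epsilon>) * s * r2"
      by (simp add: mult_ac)
  qed (use \<epsilon> r s in simp_all)
qed

section \<open>The outer bound\<close>

text \<open>
  The certificates follow from the structure of an optimal policy. In \<open>(OFF, OFF)\<close> it goes to queue 2,
  so the location makes no difference there. In \<open>(OFF, ON)\<close> it goes to queue 2 as well, and a server
  already there earns \<open>\<beta>\<close>. In \<open>(ON, OFF)\<close> it goes to queue 1, with reward \<open>\<alpha>\<close> if it is already there.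
  What depends on the objective is \<open>z\<close>, the advantage of queue 1 in \<open>(ON, ON)\<close>, and \<open>y\<close>, the value of
  going to queue 1 in \<open>(ON, OFF)\<close>. The premises \<open>K00\<close> to \<open>K11\<close> bound the expected advantage of being at
  queue 1 in the next slot, after each of the four configurations.
\<close>

lemma potential_bound_parametric:
  assumes \<epsilon>: "0 < \<epsilon>" "\<epsilon> < 1" and r: "(r1, r2) \<in> rate_region \<epsilon>"
    and "0 \<le> \<alpha>" "0 \<le> \<beta>" "0 \<le> y" "0 \<le> \<beta> + z"
    and K00: "\<epsilon> * (1 - \<epsilon>) * (\<alpha> - \<beta>) + \<epsilon>^2 * z \<le> 0"
    and K01: "\<epsilon>^2 * \<alpha> - (1 - \<epsilon>)^2 * \<beta> + \<epsilon> * (1 - \<epsilon>) * z \<le> 0"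
    and K10: "(1 - \<epsilon>)^2 * \<alpha> - \<epsilon>^2 * \<beta> + \<epsilon> * (1 - \<epsilon>) * z \<le> y"
    and K11: "\<epsilon> * (1 - \<epsilon>) * (\<alpha> - \<beta>) + (1 - \<epsilon>)^2 * z \<le> \<beta>"
      "\<alpha> + \<epsilon> * (1 - \<epsilon>) * (\<alpha> - \<beta>) + (1 - \<epsilon>)^2 * z \<le> \<beta> + z"
  shows "\<alpha> * r1 + \<beta> * r2 \<le> (2 * \<beta> + y) / 4"
proof -
  define vec where "vec a00 a01 a10 a11 c =
    (if c = (OFF, OFF) then a00 else if c = (OFF, ON) then a01
     else if c = (ON, OFF) then a10 else a11)" for a00 a01 a10 a11 :: real and c
  define D where "D = vec 0 (- \<beta>) \<alpha> z"
  define M where "M = vec 0 \<beta> y \<beta>"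
  define K where "K c = (\<Sum>c'\<in>UNIV. joint_prob \<epsilon> c c' * D c')" for c
  have K: "K (OFF, OFF) = \<epsilon> * (1 - \<epsilon>) * (\<alpha> - \<beta>) + \<epsilon>^2 * z"
    "K (OFF, ON) = \<epsilon>^2 * \<alpha> - (1 - \<epsilon>)^2 * \<beta> + \<epsilon> * (1 - \<epsilon>) * z"
    "K (ON, OFF) = (1 - \<epsilon>)^2 * \<alpha> - \<epsilon>^2 * \<beta> + \<epsilon> * (1 - \<epsilon>) * z"
    "K (ON, ON) = \<epsilon> * (1 - \<epsilon>) * (\<alpha> - \<beta>) + (1 - \<epsilon>)^2 * z"
    unfolding K_def sum_channel_pair
    by (simp_all add: joint_prob_def channel_prob_def D_def vec_def power2_eq_square algebra_simps)
  have "\<forall>c. (if snd c = ON then \<beta> else 0) \<le> M c \<and> K c \<le> M c \<and>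
      (if fst c = ON then \<alpha> else 0) + K c \<le> M c + D c \<and> 0 \<le> M c + D c"
    unfolding all_channel_pair K using assms(4-)
    by (simp add: M_def D_def vec_def)
  then have "\<alpha> * r1 + \<beta> * r2 \<le> (\<Sum>c\<in>UNIV. M c) / 4"
    by (intro potential_bound[OF \<epsilon> r, where D = D]) (simp_all only: K_def)
  also have "(\<Sum>c\<in>UNIV. M c) = 2 * \<beta> + y"
    by (simp add: sum_channel_pair M_def vec_def)
  finally show ?thesis .
qed

text \<open>By symmetry between the queues, neither location has an advantage in \<open>(ON, ON)\<close>, so \<open>z = 0\<close>.\<close>

lemma sum_rate_bound:
  assumes \<epsilon>: "0 < \<epsilon>" "\<epsilon> \<le> 1/2" and r: "(r1, r2) \<in> rate_region \<epsilon>"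
  shows "r1 + r2 \<le> 3/4 - \<epsilon>/2"
proof -
  have "1 * r1 + 1 * r2 \<le> (2 * 1 + (1 - 2*\<epsilon>)) / 4"
    by (rule potential_bound_parametric[OF _ _ r, where z = 0])
      (use \<epsilon> in \<open>simp_all add: power2_eq_square algebra_simps\<close>)
  then show ?thesis by (simp add: field_simps)
qed

text \<open>
  At the corner shared by these two edges the optimal server moves from queue 1 to queue 2 in
  \<open>(ON, ON)\<close>, where it forgoes \<open>\<beta>\<close>; hence \<open>z = - \<beta>\<close> for both. Along the first edge never
  leaving queue 2 is also optimal, so going to queue 1 in \<open>(ON, OFF)\<close> has value \<open>y = 0\<close>; along the second
  edge it has value \<open>y = 1 - 4 \<epsilon> + 2 \<epsilon>\<^sup>2\<close>.
\<close>

lemma slow_channel_bounds: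
  assumes \<epsilon>: "0 < \<epsilon>" "\<epsilon> \<le> 1/2" and slow: "0 \<le> 1 - 4*\<epsilon> + 2*\<epsilon>^2"
    and r: "(r1, r2) \<in> rate_region \<epsilon>"
  shows "\<epsilon> * r1 + (1 - \<epsilon>)^2 * r2 \<le> (1 - \<epsilon>)^2 / 2"
    and "(1 - \<epsilon>) * r1 + (1 + \<epsilon> - \<epsilon>^2) * r2 \<le> 3/4 - \<epsilon>/2"
proof -
  have cube: "\<epsilon>^3 \<le> (1 - \<epsilon>)^3"
    by (rule power_mono) (use \<epsilon> in auto)
  have sq: "\<epsilon>^2 \<le> (1 - \<epsilon>)^2"
    by (rule power_mono) (use \<epsilon> in auto)
  have \<epsilon>_le: "\<epsilon> \<le> (1 - \<epsilon>)^2"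
    using slow sq by (simp add: power2_eq_square algebra_simps)
  have "\<epsilon> * r1 + (1 - \<epsilon>)^2 * r2 \<le> (2 * (1 - \<epsilon>)^2 + 0) / 4"
  proof (rule potential_bound_parametric[OF _ _ r, where z = "- ((1 - \<epsilon>)^2)"])
    have "0 \<le> \<epsilon> * (1 - \<epsilon>) * ((1 - \<epsilon>)^2 - \<epsilon>) + \<epsilon>^2 * (1 - \<epsilon>)^2"
      using \<epsilon> \<epsilon>_le by (intro add_nonneg_nonneg mult_nonneg_nonneg) auto
    then show "\<epsilon> * (1 - \<epsilon>) * (\<epsilon> - (1 - \<epsilon>)^2) + \<epsilon>^2 * (- ((1 - \<epsilon>)^2)) \<le> 0"
      by (simp add: algebra_simps)
    have "\<epsilon>^2 * \<epsilon> - (1 - \<epsilon>)^2 * (1 - \<epsilon>)^2 + \<epsilon> * (1 - \<epsilon>) * (- ((1 - \<epsilon>)^2)) = \<epsilon>^3 - (1 - \<epsilon>)^3"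
      by (simp add: power2_eq_square power3_eq_cube algebra_simps)
    then show "\<epsilon>^2 * \<epsilon> - (1 - \<epsilon>)^2 * (1 - \<epsilon>)^2 + \<epsilon> * (1 - \<epsilon>) * (- ((1 - \<epsilon>)^2)) \<le> 0"
      using cube by simp
    show "(1 - \<epsilon>)^2 * \<epsilon> - \<epsilon>^2 * (1 - \<epsilon>)^2 + \<epsilon> * (1 - \<epsilon>) * (- ((1 - \<epsilon>)^2)) \<le> 0"
      by (simp add: power2_eq_square algebra_simps)
    have K: "\<epsilon> * (1 - \<epsilon>) * (\<epsilon> - (1 - \<epsilon>)^2) + (1 - \<epsilon>)^2 * (- ((1 - \<epsilon>)^2))
        = - \<epsilon> - (1 - 4*\<epsilon> + 2*\<epsilon>^2)"
      by (simp add: power2_eq_square algebra_simps)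
    then show "\<epsilon> * (1 - \<epsilon>) * (\<epsilon> - (1 - \<epsilon>)^2) + (1 - \<epsilon>)^2 * (- ((1 - \<epsilon>)^2)) \<le> (1 - \<epsilon>)^2"
      using slow \<epsilon>(1) \<epsilon>_le by linarith
    show "\<epsilon> + \<epsilon> * (1 - \<epsilon>) * (\<epsilon> - (1 - \<epsilon>)^2) + (1 - \<epsilon>)^2 * (- ((1 - \<epsilon>)^2))
        \<le> (1 - \<epsilon>)^2 + - ((1 - \<epsilon>)^2)"
      using K slow by linarith
  qed (use \<epsilon> in simp_all)
  then show "\<epsilon> * r1 + (1 - \<epsilon>)^2 * r2 \<le> (1 - \<epsilon>)^2 / 2"
    by simp
  define \<beta> where "\<beta> = 1 + \<epsilon> - \<epsilon>^2"
  have \<beta>: "1 \<le> \<beta>"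
    using \<epsilon> by (simp add: \<beta>_def power2_eq_square)
  have "(1 - \<epsilon>) * r1 + \<beta> * r2 \<le> (2 * \<beta> + (1 - 4*\<epsilon> + 2*\<epsilon>^2)) / 4"
  proof (rule potential_bound_parametric[OF _ _ r, where z = "- \<beta>"])
    have "0 \<le> \<epsilon> * (1 - \<epsilon>) * (\<beta> - (1 - \<epsilon>)) + \<epsilon>^2 * \<beta>"
      using \<epsilon> \<beta> by (intro add_nonneg_nonneg mult_nonneg_nonneg) auto
    then show "\<epsilon> * (1 - \<epsilon>) * ((1 - \<epsilon>) - \<beta>) + \<epsilon>^2 * (- \<beta>) \<le> 0"
      by (simp add: algebra_simps)
    have "\<epsilon>^2 \<le> 1^2"
      by (rule power_mono) (use \<epsilon> in auto)
    then have "0 \<le> (1 - \<epsilon>) * (\<beta> - \<epsilon>^2)"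
      using \<epsilon> \<beta> by (intro mult_nonneg_nonneg) auto
    then show "\<epsilon>^2 * (1 - \<epsilon>) - (1 - \<epsilon>)^2 * \<beta> + \<epsilon> * (1 - \<epsilon>) * (- \<beta>) \<le> 0"
      by (simp add: power2_eq_square algebra_simps)
    show "(1 - \<epsilon>)^2 * (1 - \<epsilon>) - \<epsilon>^2 * \<beta> + \<epsilon> * (1 - \<epsilon>) * (- \<beta>) \<le> 1 - 4*\<epsilon> + 2*\<epsilon>^2"
      by (simp add: \<beta>_def power2_eq_square algebra_simps)
    have K: "\<epsilon> * (1 - \<epsilon>) * ((1 - \<epsilon>) - \<beta>) + (1 - \<epsilon>)^2 * (- \<beta>) = - (1 - \<epsilon>)"
      by (simp add: \<beta>_def power2_eq_square algebra_simps)
    then show "\<epsilon> * (1 - \<epsilon>) * ((1 - \<epsilon>) - \<beta>) + (1 - \<epsilon>)^2 * (- \<beta>) \<le> \<beta>"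
      using \<epsilon> \<beta> by linarith
    show "(1 - \<epsilon>) + \<epsilon> * (1 - \<epsilon>) * ((1 - \<epsilon>) - \<beta>) + (1 - \<epsilon>)^2 * (- \<beta>) \<le> \<beta> + - \<beta>"
      using K by linarith
  qed (use \<epsilon> \<beta> slow in simp_all)
  also have "(2 * \<beta> + (1 - 4*\<epsilon> + 2*\<epsilon>^2)) / 4 = 3/4 - \<epsilon>/2"
    by (simp add: \<beta>_def field_simps)
  finally show "(1 - \<epsilon>) * r1 + (1 + \<epsilon> - \<epsilon>^2) * r2 \<le> 3/4 - \<epsilon>/2"
    by (simp add: \<beta>_def)
qed

text \<open>
  Never leaving queue 2 is optimal here, so \<open>y = 0\<close>. The value \<open>z\<close> is the one for which going to queue 1
  and staying idle at queue 2 tie in \<open>(ON, OFF)\<close>, that is, for which \<open>K10\<close> holds with equality. The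
  objective is scaled by \<open>\<epsilon>\<close> to keep \<open>z\<close> a polynomial.
\<close>

lemma fast_channel_bound:
  assumes \<epsilon>: "0 < \<epsilon>" "\<epsilon> \<le> 1/2" and fast: "1 - 4*\<epsilon> + 2*\<epsilon>^2 \<le> 0"
    and r: "(r1, r2) \<in> rate_region \<epsilon>"
  shows "r1 + (1 - \<epsilon>) * (3 - 2*\<epsilon>) * r2 \<le> (1 - \<epsilon>) * (3 - 2*\<epsilon>) / 2"
proof -
  define \<gamma> where "\<gamma> = (1 - \<epsilon>) * (3 - 2*\<epsilon>)"
  define z where "z = - ((1 - 2*\<epsilon>) * (1 + \<epsilon> - \<epsilon>^2))"
  have "0 \<le> (1 - 2*\<epsilon>) * (2 - \<epsilon>)"
    using \<epsilon> by (intro mult_nonneg_nonneg) auto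
  then have \<gamma>: "1 \<le> \<gamma>"
    by (simp add: \<gamma>_def algebra_simps)
  have z: "z \<le> 0"
    using \<epsilon> unfolding z_def neg_le_0_iff_le
    by (intro mult_nonneg_nonneg) (auto simp: power2_eq_square algebra_simps intro: add_increasing)
  have sq: "\<epsilon>^2 \<le> (1 - \<epsilon>)^2"
    by (rule power_mono) (use \<epsilon> in auto)
  have "\<epsilon> * r1 + (\<epsilon> * \<gamma>) * r2 \<le> (2 * (\<epsilon> * \<gamma>) + 0) / 4"
  proof (rule potential_bound_parametric[OF _ _ r, where z = z])
    show "0 \<le> \<epsilon> * \<gamma> + z"
    proof -
      have "\<epsilon> * \<gamma> + z = - (1 - 4*\<epsilon> + 2*\<epsilon>^2)"
        by (simp add: \<gamma>_def z_def power2_eq_square algebra_simps)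
      then show ?thesis using fast by simp
    qed
    have "0 \<le> \<epsilon> * (1 - \<epsilon>) * (\<epsilon> * (\<gamma> - 1)) + \<epsilon>^2 * (- z)"
      using \<epsilon> \<gamma> z by (intro add_nonneg_nonneg mult_nonneg_nonneg) auto
    then show "\<epsilon> * (1 - \<epsilon>) * (\<epsilon> - \<epsilon> * \<gamma>) + \<epsilon>^2 * z \<le> 0"
      by (simp add: algebra_simps)
    have "\<epsilon>^2 * 1 \<le> (1 - \<epsilon>)^2 * \<gamma>"
      using sq \<gamma> by (intro mult_mono) auto
    then have "0 \<le> \<epsilon> * ((1 - \<epsilon>)^2 * \<gamma> - \<epsilon>^2) + \<epsilon> * (1 - \<epsilon>) * (- z)"
      using \<epsilon> z by (intro add_nonneg_nonneg mult_nonneg_nonneg) auto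
    then show "\<epsilon>^2 * \<epsilon> - (1 - \<epsilon>)^2 * (\<epsilon> * \<gamma>) + \<epsilon> * (1 - \<epsilon>) * z \<le> 0"
      by (simp add: algebra_simps)
    show "(1 - \<epsilon>)^2 * \<epsilon> - \<epsilon>^2 * (\<epsilon> * \<gamma>) + \<epsilon> * (1 - \<epsilon>) * z \<le> 0"
      by (simp add: \<gamma>_def z_def power2_eq_square algebra_simps)
    have K: "\<epsilon> * (1 - \<epsilon>) * (\<epsilon> - \<epsilon> * \<gamma>) + (1 - \<epsilon>)^2 * z = \<epsilon> * \<gamma> + z - \<epsilon>"
      by (simp add: \<gamma>_def z_def power2_eq_square algebra_simps)
    then show "\<epsilon> * (1 - \<epsilon>) * (\<epsilon> - \<epsilon> * \<gamma>) + (1 - \<epsilon>)^2 * z \<le> \<epsilon> * \<gamma>"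
      using \<epsilon> z by linarith
    show "\<epsilon> + \<epsilon> * (1 - \<epsilon>) * (\<epsilon> - \<epsilon> * \<gamma>) + (1 - \<epsilon>)^2 * z \<le> \<epsilon> * \<gamma> + z"
      using K by linarith
  qed (use \<epsilon> \<gamma> in simp_all)
  then have "\<epsilon> * (r1 + \<gamma> * r2) \<le> \<epsilon> * (\<gamma> / 2)"
    by (simp add: algebra_simps)
  then show ?thesis
    using \<epsilon>(1) by (simp add: \<gamma>_def)
qed

section \<open>The rate region\<close>

lemma eps_crit_iff:
  assumes "\<epsilon> \<le> 1"
  shows "\<epsilon> < eps_crit \<longleftrightarrow> 0 < 1 - 4*\<epsilon> + 2*\<epsilon>^2"
proof -
  have "\<epsilon> < eps_crit \<longleftrightarrow> sqrt 2 < 2 * (1 - \<epsilon>)"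
    by (auto simp: eps_crit_def)
  also have "\<dots> \<longleftrightarrow> 2 < (2 * (1 - \<epsilon>))^2"
    using assms by (metis abs_of_nonneg diff_ge_0_iff_ge mult_nonneg_nonneg real_sqrt_abs
        real_sqrt_less_iff zero_le_numeral)
  also have "\<dots> \<longleftrightarrow> 0 < 1 - 4*\<epsilon> + 2*\<epsilon>^2"
  proof -
    have "(2 * (1 - \<epsilon>))^2 - 2 = 2 * (1 - 4*\<epsilon> + 2*\<epsilon>^2)"
      by (simp add: power2_eq_square algebra_simps)
    then have "2 < (2 * (1 - \<epsilon>))^2 \<longleftrightarrow> 0 < 2 * (1 - 4*\<epsilon> + 2*\<epsilon>^2)"
      by (metis diff_gt_0_iff_gt)
    then show ?thesis by (simp only: zero_less_mult_iff) simp
  qed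
  finally show ?thesis .
qed

text \<open>
  The region is symmetric under exchanging the queues, so each edge has to be bounded on one side of
  the diagonal only, and each point has to be achieved only for \<open>r1 \<le> r2\<close>.
\<close>

lemma rate_region_eqI:
  assumes bound: "\<And>r1 r2. (r1, r2) \<in> rate_region \<epsilon> \<Longrightarrow> Q r1 r2"
    and achieve: "\<And>r1 r2. 0 \<le> r1 \<Longrightarrow> r1 \<le> r2 \<Longrightarrow> Q r1 r2 \<Longrightarrow> (r1, r2) \<in> rate_region \<epsilon>"
  shows "rate_region \<epsilon> = {(r1, r2). 0 \<le> r1 \<and> 0 \<le> r2 \<and> Q r1 r2 \<and> Q r2 r1}"
proof (intro set_eqI iffI)
  fix r assume "r \<in> rate_region \<epsilon>"
  then show "r \<in> {(r1, r2). 0 \<le> r1 \<and> 0 \<le> r2 \<and> Q r1 r2 \<and> Q r2 r1}"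
    using bound rate_region_swap rate_region_nonneg by (cases r) blast
next
  fix r assume "r \<in> {(r1, r2). 0 \<le> r1 \<and> 0 \<le> r2 \<and> Q r1 r2 \<and> Q r2 r1}"
  then obtain r1 r2 where "r = (r1, r2)" "0 \<le> r1" "0 \<le> r2" "Q r1 r2" "Q r2 r1"
    by auto
  then show "r \<in> rate_region \<epsilon>"
    using achieve[of r1 r2] rate_region_swap[OF achieve[of r2 r1]]
    by (cases "r1 \<le> r2") auto
qed

theorem theorem3:
  fixes \<epsilon> :: real
  assumes "0 < \<epsilon>" and "\<epsilon> \<le> 1/2"
  shows "(\<epsilon> < eps_crit \<longrightarrow>
            rate_region \<epsilon> = {(r1, r2). 0 \<le> r1 \<and> 0 \<le> r2 \<and>
              \<epsilon> * r1 + (1 - \<epsilon>)^2 * r2 \<le> (1 - \<epsilon>)^2 / 2 \<and>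
              (1 - \<epsilon>) * r1 + (1 + \<epsilon> - \<epsilon>^2) * r2 \<le> 3/4 - \<epsilon>/2 \<and>
              r1 + r2 \<le> 3/4 - \<epsilon>/2 \<and>
              (1 + \<epsilon> - \<epsilon>^2) * r1 + (1 - \<epsilon>) * r2 \<le> 3/4 - \<epsilon>/2 \<and>
              (1 - \<epsilon>)^2 * r1 + \<epsilon> * r2 \<le> (1 - \<epsilon>)^2 / 2}) \<and>
         (\<epsilon> \<ge> eps_crit \<longrightarrow>
            rate_region \<epsilon> = {(r1, r2). 0 \<le> r1 \<and> 0 \<le> r2 \<and>
              r1 + (1 - \<epsilon>) * (3 - 2*\<epsilon>) * r2 \<le> (1 - \<epsilon>) * (3 - 2*\<epsilon>) / 2 \<and>
              r1 + r2 \<le> 3/4 - \<epsilon>/2 \<and>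
              (1 - \<epsilon>) * (3 - 2*\<epsilon>) * r1 + r2 \<le> (1 - \<epsilon>) * (3 - 2*\<epsilon>) / 2})"
proof (intro conjI impI)
  have \<epsilon>: "0 < \<epsilon>" "\<epsilon> < 1" "\<epsilon> \<le> 1"
    using assms by auto
  note crit = eps_crit_iff[OF \<epsilon>(3)]
  define slow where "slow r1 r2 \<longleftrightarrow>
      \<epsilon> * r1 + (1 - \<epsilon>)^2 * r2 \<le> (1 - \<epsilon>)^2 / 2 \<and>
      (1 - \<epsilon>) * r1 + (1 + \<epsilon> - \<epsilon>^2) * r2 \<le> 3/4 - \<epsilon>/2 \<and>
      r1 + r2 \<le> 3/4 - \<epsilon>/2" for r1 r2
  assume "\<epsilon> < eps_crit"
  then have "0 \<le> 1 - 4*\<epsilon> + 2*\<epsilon>^2"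
    using crit by simp
  then have "rate_region \<epsilon> = {(r1, r2). 0 \<le> r1 \<and> 0 \<le> r2 \<and> slow r1 r2 \<and> slow r2 r1}"
    using slow_channel_bounds sum_rate_bound slow_channel_achievable[OF \<epsilon>(1,2)] assms
    by (intro rate_region_eqI) (auto simp: slow_def)
  then show "rate_region \<epsilon> = {(r1, r2). 0 \<le> r1 \<and> 0 \<le> r2 \<and>
              \<epsilon> * r1 + (1 - \<epsilon>)^2 * r2 \<le> (1 - \<epsilon>)^2 / 2 \<and>
              (1 - \<epsilon>) * r1 + (1 + \<epsilon> - \<epsilon>^2) * r2 \<le> 3/4 - \<epsilon>/2 \<and>
              r1 + r2 \<le> 3/4 - \<epsilon>/2 \<and>
              (1 + \<epsilon> - \<epsilon>^2) * r1 + (1 - \<epsilon>) * r2 \<le> 3/4 - \<epsilon>/2 \<and>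
              (1 - \<epsilon>)^2 * r1 + \<epsilon> * r2 \<le> (1 - \<epsilon>)^2 / 2}"
    by (auto simp: slow_def add.commute)
next
  have \<epsilon>: "0 < \<epsilon>" "\<epsilon> < 1" "\<epsilon> \<le> 1"
    using assms by auto
  note crit = eps_crit_iff[OF \<epsilon>(3)]
  define fast where "fast r1 r2 \<longleftrightarrow>
      r1 + (1 - \<epsilon>) * (3 - 2*\<epsilon>) * r2 \<le> (1 - \<epsilon>) * (3 - 2*\<epsilon>) / 2 \<and>
      r1 + r2 \<le> 3/4 - \<epsilon>/2" for r1 r2
  assume "\<epsilon> \<ge> eps_crit"
  then have "1 - 4*\<epsilon> + 2*\<epsilon>^2 \<le> 0"
    using crit by linarith
  then have "rate_region \<epsilon> = {(r1, r2). 0 \<le> r1 \<and> 0 \<le> r2 \<and> fast r1 r2 \<and> fast r2 r1}"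
    using fast_channel_bound sum_rate_bound fast_channel_achievable[OF \<epsilon>(1,2)] assms
    by (intro rate_region_eqI) (auto simp: fast_def)
  then show "rate_region \<epsilon> = {(r1, r2). 0 \<le> r1 \<and> 0 \<le> r2 \<and>
              r1 + (1 - \<epsilon>) * (3 - 2*\<epsilon>) * r2 \<le> (1 - \<epsilon>) * (3 - 2*\<epsilon>) / 2 \<and>
              r1 + r2 \<le> 3/4 - \<epsilon>/2 \<and>
              (1 - \<epsilon>) * (3 - 2*\<epsilon>) * r1 + r2 \<le> (1 - \<epsilon>) * (3 - 2*\<epsilon>) / 2}"
    by (auto simp: fast_def add.commute)
qed

end
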